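(* Fix $\delta,\beta\in(0,1)$, $K\ge1$, $\eta\ge0$, and suppose that $0\le\rho<\delta$. Let $R^{(1)},\ldots,R^{(K)}$ be i.i.d. with distribution $\mathbb{P}\in\mathcal{P}(\mathcal{X})$ and let $R^{(0)}$ be an independent random variable with distribution $\mathbb{P}_{\mathrm{test}}\in\mathcal{P}(\mathcal{X})$, where $\mathrm{LP}_\eta(\mathbb{P},\mathbb{P}_{\mathrm{test}})\le\rho$. Define $$\bar\alpha_{\mathrm{LP\text{-}CP}}^{\mathrm{test}}:=\mathrm{Quantile}_{1-\delta+\sqrt{\frac{\ln(1/\beta)}{2K}}+\rho}(R^{(1)},\ldots,R^{(K)},\infty)+\eta,$$ and assume that the quantile level satisfies $$\frac{1}{K+1}\le 1-\delta+\sqrt{\frac{\ln(1/\beta)}{2K}}+\rho\le\frac{K}{K+1}.$$ Then $$\mathbb{P}^K\Bigl(\mathbb{P}_{\mathrm{test}}\bigl(R^{(0)}\le\bar\alpha_{\mathrm{LP\text{-}CP}}^{\mathrm{test}}\bigr)\ge1-\delta\Bigr)\ge1-\beta,$$ where the inner probability is over $R^{(0)}\sim\mathbb{P}_{\mathrm{test}}$ with the calibration samples fixed and the outer one is over $R^{(1)},\ldots,R^{(K)}$.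
   Context: $\mathcal{X}\subseteq\mathbb{R}$ with its Borel $\sigma$-algebra, and $\mathcal{P}(\mathcal{X})$ is the set of Borel probability measures on $\mathcal{X}$. $\mathbb{P}^K=\mathbb{P}^{\otimes K}$. For values $a_1,\ldots,a_n\in\mathbb{R}\cup\{\infty\}$ and $p\in(0,1)$, $\mathrm{Quantile}_p(a_1,\ldots,a_n)$ is the $\lceil np\rceil$-th smallest of them. For $\epsilon\ge0$ the L\'evy--Prokhorov discrepancy is $$\mathrm{LP}_\epsilon(\mathbb{P}_1,\mathbb{P}_2):=\inf_{\pi\in\Gamma(\mathbb{P}_1,\mathbb{P}_2)}\int_{\mathcal{X}\times\mathcal{X}}\mathbf{1}\{|x_1-x_2|>\epsilon\}\,d\pi(x_1,x_2),$$ where $\Gamma(\mathbb{P}_1,\mathbb{P}_2)$ is the set of couplings of $\mathbb{P}_1$ and $\mathbb{P}_2$. *)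

theory Defs
  imports "HOL-Probability.Probability"
begin

abbreviation borel_prob_measures :: "real set \<Rightarrow> real measure set" where
  "borel_prob_measures X \<equiv> space (prob_algebra (restrict_space borel X))"

definition couplings :: "real measure \<Rightarrow> real measure \<Rightarrow> (real \<times> real) measure set" where
  "couplings P1 P2 =
     {\<pi> \<in> space (prob_algebra (P1 \<Otimes>\<^sub>M P2)). distr \<pi> P1 fst = P1 \<and> distr \<pi> P2 snd = P2}"

(* For probability measures the infimum is over a nonempty set (the product measure is a
   coupling) of reals in [0, 1], so the conditionally complete INF is the true infimum. *)
definition levy_prokhorov :: "real \<Rightarrow> real measure \<Rightarrow> real measure \<Rightarrow> real" where
  "levy_prokhorov \<epsilon> P1 P2 =
     (INF \<pi>\<in>couplings P1 P2. \<integral>x. indicator {(x1, x2). \<bar>x1 - x2\<bar> > \<epsilon>} x \<partial>\<pi>)"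

(* The ceil(n p)-th smallest of n values; list positions start at 0, hence the "- 1".
   Meant for nonempty lists and 0 < p < 1, where ceil(n p) lies between 1 and n. *)
definition quantile :: "real \<Rightarrow> ereal list \<Rightarrow> ereal" where
  "quantile p as = sort as ! (nat \<lceil>real (length as) * p\<rceil> - 1)"

definition lp_cp_level :: "real \<Rightarrow> real \<Rightarrow> nat \<Rightarrow> real \<Rightarrow> real" where
  "lp_cp_level \<delta> \<beta> K \<rho> = 1 - \<delta> + sqrt (ln (1 / \<beta>) / (2 * real K)) + \<rho>"

(* R i is the i-th calibration sample, i = 1, ..., K. *)
definition lp_cp_threshold ::
    "real \<Rightarrow> real \<Rightarrow> nat \<Rightarrow> real \<Rightarrow> real \<Rightarrow> (nat \<Rightarrow> real) \<Rightarrow> ereal" where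
  "lp_cp_threshold \<delta> \<beta> K \<rho> \<eta> R =
     quantile (lp_cp_level \<delta> \<beta> K \<rho>) (map (\<lambda>i. ereal (R i)) [1..<Suc K] @ [\<infinity>]) + ereal \<eta>"

(* The K-fold product measure: the joint law of K i.i.d. samples from P, which are the
   coordinates indexed by 1, ..., K. *)
abbreviation iid_law :: "nat \<Rightarrow> real measure \<Rightarrow> (nat \<Rightarrow> real) measure" where
  "iid_law K P \<equiv> Pi\<^sub>M {1..K} (\<lambda>_. P)"

end

theory Submission
  imports Defs
begin

text \<open>
  Let \<open>G\<close> be the distribution function of the test distribution and \<open>y\<close> its \<open>(1 - \<delta>)\<close>-quantile, so
  that \<open>G(t) \<ge> 1 - \<delta>\<close> holds exactly for \<open>t \<ge> y\<close>. Coverage at level \<open>1 - \<delta>\<close> therefore means that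
  the empirical quantile of the calibration samples is at least \<open>z = y - \<eta>\<close>, that is, that fewer than
  \<open>\<lceil>(K + 1) p\<rceil>\<close> of the samples are smaller than \<open>z\<close>, where \<open>p\<close> is the quantile level
  (lemmas \<open>quantile_exists\<close> and \<open>le_quantile_iff\<close>).

  A single sample is smaller than \<open>z\<close> with probability at most \<open>1 - \<delta> + \<rho>\<close>: under a coupling, a
  calibration point below \<open>y - \<eta>\<close> is either more than \<open>\<eta>\<close> away from its test partner, or the partner
  lies below \<open>y\<close>. The first event costs \<open>\<rho>\<close> after taking the infimum over all couplings; the second
  has probability at most \<open>1 - \<delta>\<close>, as \<open>y\<close> is a quantile
  (lemma \<open>measure_lessThan_le_levy_prokhorov\<close>).

  Coverage thus fails only if the number of samples below \<open>z\<close> is at least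
  \<open>(K + 1) p \<ge> K (1 - \<delta> + \<rho> + c)\<close> with \<open>c = sqrt (ln (1 / \<beta>) / (2 K))\<close>, that is, exceeds its
  mean by at least \<open>K c\<close>. By Hoeffding's inequality this has probability at most
  \<open>exp (- 2 K c\<^sup>2) = \<beta>\<close> (lemma \<open>prob_empirical_count_ge_le\<close>).

  Working with \<open>z\<close>, a fixed number, instead of with the distribution function at the random
  empirical quantile has the further advantage that the coverage event is visibly measurable: it
  is described by a finite sum of indicators.
\<close>

section \<open>Order statistics and counting\<close>

lemma le_nth_sorted_iff:
  fixes z :: "'a::linorder"
  assumes "sorted xs" and "j < length xs"
  shows "z \<le> xs ! j \<longleftrightarrow> length (filter (\<lambda>x. x < z) xs) \<le> j"
  using assms
proof (induction xs arbitrary: j)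
  case Nil
  then show ?case by simp
next
  case (Cons x xs)
  show ?case
  proof (cases "z \<le> x")
    case True
    then have "\<forall>w\<in>set (x # xs). z \<le> w"
      using Cons.prems(1) by auto
    moreover from this have "filter (\<lambda>w. w < z) (x # xs) = []"
      by (auto simp: filter_empty_conv)
    ultimately show ?thesis
      using Cons.prems(2) nth_mem[of j "x # xs"] by (metis list.size(3) le0)
  next
    case False
    with Cons show ?thesis
      by (cases j) auto
  qed
qed

lemma le_nth_sort_iff:
  fixes z :: "'a::linorder"
  assumes "j < length xs"
  shows "z \<le> sort xs ! j \<longleftrightarrow> length (filter (\<lambda>x. x < z) xs) \<le> j"
  using le_nth_sorted_iff[of "sort xs" j z] assms by (simp add: filter_sort)

lemma quantile_rank_bounds:
  assumes "0 < p" "p \<le> 1" "0 < n"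
  shows "0 < \<lceil>real n * p\<rceil>" and "\<lceil>real n * p\<rceil> \<le> int n"
proof -
  show "0 < \<lceil>real n * p\<rceil>" using assms by simp
  have "real n * p \<le> real n" using assms(2) by (simp add: mult_left_le)
  then show "\<lceil>real n * p\<rceil> \<le> int n" by (simp add: ceiling_le_iff)
qed

text \<open>
  This turns the condition on the empirical quantile into a condition on a sum of
  indicators: the \<open>k\<close>-th smallest entry is at least \<open>z\<close> exactly when fewer than \<open>k\<close> entries lie
  below \<open>z\<close>. The entry \<open>\<infinity>\<close> lies below nothing, so only the samples count. As the count is an
  integer, it is below \<open>k = \<lceil>(K + 1) p\<rceil>\<close> exactly when it is below \<open>(K + 1) p\<close>.
\<close>
lemma le_quantile_iff:
  fixes R :: "nat \<Rightarrow> real" and z p :: real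
  assumes "0 < p" "p \<le> 1"
  shows "ereal z \<le> quantile p (map (\<lambda>i. ereal (R i)) [1..<Suc K] @ [\<infinity>]) \<longleftrightarrow>
    (\<Sum>i\<in>{1..K}. indicator {..<z} (R i)) < real (K + 1) * p"
proof -
  let ?xs = "map (\<lambda>i. ereal (R i)) [1..<Suc K] @ [\<infinity>]"
  let ?k = "\<lceil>real (K + 1) * p\<rceil>"
  let ?n = "card {i\<in>{1..K}. R i < z}"
  have len: "length ?xs = K + 1" by simp
  have k: "0 < ?k" "?k \<le> int (K + 1)"
    using quantile_rank_bounds[OF assms, of "K + 1"] by simp_all
  then have index: "nat ?k - 1 < length ?xs" by simp linarith
  have "length (filter (\<lambda>a. a < ereal z) ?xs) = length (filter (\<lambda>i. R i < z) [1..<Suc K])"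
    by (simp add: filter_map o_def)
  also have "\<dots> = card (set (filter (\<lambda>i. R i < z) [1..<Suc K]))"
    by (simp only: distinct_card distinct_filter distinct_upt)
  also have "set (filter (\<lambda>i. R i < z) [1..<Suc K]) = {i\<in>{1..K}. R i < z}"
    by auto
  finally have count: "length (filter (\<lambda>a. a < ereal z) ?xs) = ?n" .
  have sum_eq: "(\<Sum>i\<in>{1..K}. indicator {..<z} (R i)) = real ?n"
    by (simp add: indicator_def sum.If_cases Int_def)
  have "ereal z \<le> quantile p ?xs \<longleftrightarrow> ?n \<le> nat ?k - 1"
    unfolding quantile_def len using le_nth_sort_iff[OF index, of "ereal z"] count by simp
  also have "\<dots> \<longleftrightarrow> int ?n < ?k"
    using k by linarith
  also have "\<dots> \<longleftrightarrow> real ?n < real (K + 1) * p"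
    by (simp add: less_ceiling_iff)
  finally show ?thesis using sum_eq by simp
qed

lemma quantile_in_set:
  assumes "as \<noteq> []" "0 < p" "p \<le> 1"
  shows "quantile p as \<in> set as"
proof -
  have "\<lceil>real (length as) * p\<rceil> \<le> int (length as)"
    using quantile_rank_bounds(2)[of p "length as"] assms by blast
  then have "nat \<lceil>real (length as) * p\<rceil> - 1 < length (sort as)"
    using assms(1) by (cases as) (auto simp del: length_Cons)
  then have "sort as ! (nat \<lceil>real (length as) * p\<rceil> - 1) \<in> set (sort as)"
    by (rule nth_mem)
  then show ?thesis by (simp add: quantile_def)
qed

section \<open>The quantile of a distribution on the line\<close>

text \<open>
  The infimum of \<open>{t. q \<le> cdf M t}\<close> is attained by right continuity, which gives the equivalence.
  To the left of it the distribution function stays below \<open>q\<close>, so its left limit, the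
  mass of the open half-line, is at most \<open>q\<close>; the bound \<open>measure M {..y} \<le> q\<close> can fail if \<open>y\<close> is an atom.
\<close>
lemma (in real_distribution) quantile_exists:
  assumes "0 < q" "q < 1"
  obtains y where "\<And>t. q \<le> cdf M t \<longleftrightarrow> y \<le> t" and "measure M {..<y} \<le> q"
proof -
  let ?S = "{t. q \<le> cdf M t}"
  define y where "y = Inf ?S"
  have "eventually (\<lambda>t. q < cdf M t) at_top"
    using order_tendstoD(1)[OF cdf_lim_at_top_prob assms(2)] .
  then obtain t1 where "q < cdf M t1"
    by (metis eventually_at_top_linorder order_refl)
  then have ne: "?S \<noteq> {}" by (auto intro: less_imp_le)
  have "eventually (\<lambda>t. cdf M t < q) at_bot"
    using order_tendstoD(2)[OF cdf_lim_at_bot assms(1)] .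
  then obtain t0 where t0: "cdf M t0 < q"
    by (metis eventually_at_bot_linorder order_refl)
  have bdd: "bdd_below ?S"
  proof (rule bdd_belowI)
    fix t assume "t \<in> ?S"
    then show "t0 \<le> t"
      using t0 cdf_nondecreasing[of t t0] by force
  qed
  have above: "q \<le> cdf M t" if "y < t" for t
  proof -
    obtain s where "s \<in> ?S" "s < t"
      using \<open>y < t\<close> cInf_less_iff[OF ne bdd] unfolding y_def by auto
    then show ?thesis using cdf_nondecreasing[of s t] by auto
  qed
  have below: "cdf M t < q" if "t < y" for t
    using that cInf_lower[OF _ bdd, of t] unfolding y_def by force
  have "q \<le> cdf M y"
  proof (rule tendsto_lowerbound)
    show "(cdf M \<longlongrightarrow> cdf M y) (at_right y)"
      using cdf_is_right_cont[of y] by (simp add: continuous_within)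
    show "eventually (\<lambda>t. q \<le> cdf M t) (at_right y)"
      by (rule eventually_at_rightI[of y "y + 1"]) (auto intro: above)
  qed simp
  then have iff: "q \<le> cdf M t \<longleftrightarrow> y \<le> t" for t
    using above below by (metis not_le order_le_less)
  have "measure M {..<y} \<le> q"
  proof (rule tendsto_upperbound)
    show "(cdf M \<longlongrightarrow> measure M {..<y}) (at_left y)" by (rule cdf_at_left)
    show "eventually (\<lambda>t. cdf M t \<le> q) (at_left y)"
      by (rule eventually_at_leftI[of "y - 1"]) (auto intro: below less_imp_le)
  qed simp
  with iff show thesis by (rule that)
qed

section \<open>Transfer of probabilities along couplings\<close>

lemma pair_measure_in_couplings:
  assumes "prob_space P1" "prob_space P2"
  shows "P1 \<Otimes>\<^sub>M P2 \<in> couplings P1 P2"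
proof -
  interpret P1: prob_space P1 by fact
  interpret P2: prob_space P2 by fact
  interpret P12: pair_prob_space P1 P2 ..
  have "distr (P1 \<Otimes>\<^sub>M P2) P2 snd = distr (P2 \<Otimes>\<^sub>M P1) P2 fst"
    by (subst P12.distr_pair_swap, subst distr_distr) (auto simp: o_def case_prod_beta)
  then show ?thesis
    using P12.prob_space_axioms
    by (simp add: couplings_def space_prob_algebra P2.distr_pair_fst P1.distr_pair_fst)
qed

text \<open>
  If \<open>x1 < y - \<epsilon>\<close>, then \<open>x2 < y\<close> or \<open>\<bar>x1 - x2\<bar> > \<epsilon>\<close>; the marginals of the coupling give
  the probabilities of the first two events. The half-lines are open because only the mass
  strictly to the left of a quantile is bounded by its level.
\<close>
lemma coupling_measure_lessThan_le:
  assumes [measurable]: "(\<lambda>x. x) \<in> borel_measurable P1" "(\<lambda>x. x) \<in> borel_measurable P2"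
    and "\<pi> \<in> couplings P1 P2"
  shows "measure P1 {x\<in>space P1. x < y - \<epsilon>} - measure P2 {x\<in>space P2. x < y}
    \<le> (\<integral>x. indicator {(x1, x2). \<bar>x1 - x2\<bar> > \<epsilon>} x \<partial>\<pi>)"
proof -
  have prob: "prob_space \<pi>" and sets_eq [measurable_cong]: "sets \<pi> = sets (P1 \<Otimes>\<^sub>M P2)"
    and fst: "distr \<pi> P1 fst = P1" and snd: "distr \<pi> P2 snd = P2"
    using assms(3) by (auto simp: couplings_def space_prob_algebra)
  interpret prob_space \<pi> by (rule prob)
  have [measurable]: "fst \<in> borel_measurable \<pi>" "snd \<in> borel_measurable \<pi>"
    using measurable_compose[OF measurable_fst assms(1)] measurable_compose[OF measurable_snd assms(2)]
    by (simp_all add: measurable_cong_sets[OF sets_eq refl])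
  let ?A = "{x\<in>space \<pi>. fst x < y - \<epsilon>}" and ?B = "{x\<in>space \<pi>. snd x < y}"
  let ?D = "{x\<in>space \<pi>. \<epsilon> < \<bar>fst x - snd x\<bar>}"
  have space_eq: "space \<pi> = space P1 \<times> space P2"
    using sets_eq_imp_space_eq[OF sets_eq] by (simp add: space_pair_measure)
  have "measure P1 {x\<in>space P1. x < y - \<epsilon>} = measure (distr \<pi> P1 fst) {x\<in>space P1. x < y - \<epsilon>}"
    by (simp add: fst)
  also have "\<dots> = prob ?A"
    by (subst measure_distr) (auto intro!: arg_cong[where f = prob] simp: space_eq)
  also have "\<dots> \<le> prob (?B \<union> ?D)"
    by (rule finite_measure_mono) auto
  also have "\<dots> \<le> prob ?B + prob ?D"
    by (rule measure_Un_le) auto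
  also have "prob ?B = measure (distr \<pi> P2 snd) {x\<in>space P2. x < y}"
    by (subst measure_distr) (auto intro!: arg_cong[where f = prob] simp: space_eq)
  also have "\<dots> = measure P2 {x\<in>space P2. x < y}"
    by (simp add: snd)
  also have "prob ?D = (\<integral>x. indicator {(x1, x2). \<bar>x1 - x2\<bar> > \<epsilon>} x \<partial>\<pi>)"
    by (subst Bochner_Integration.integral_indicator) (auto intro!: arg_cong[where f = prob])
  finally show ?thesis by simp
qed

text \<open>
  The left-hand side of the previous bound does not depend on the coupling, so it is also a lower
  bound for the infimum. The product coupling shows that the
  infimum is over a nonempty set.
\<close>
lemma measure_lessThan_le_levy_prokhorov:
  assumes "prob_space P1" "prob_space P2"
    and "(\<lambda>x. x) \<in> borel_measurable P1" "(\<lambda>x. x) \<in> borel_measurable P2"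
  shows "measure P1 {x\<in>space P1. x < y - \<epsilon>}
    \<le> measure P2 {x\<in>space P2. x < y} + levy_prokhorov \<epsilon> P1 P2"
proof -
  have "measure P1 {x\<in>space P1. x < y - \<epsilon>} - measure P2 {x\<in>space P2. x < y}
      \<le> levy_prokhorov \<epsilon> P1 P2"
    unfolding levy_prokhorov_def
  proof (rule cINF_greatest)
    show "couplings P1 P2 \<noteq> {}"
      using pair_measure_in_couplings[OF assms(1,2)] by blast
  qed (rule coupling_measure_lessThan_le[OF assms(3,4)])
  then show ?thesis by simp
qed

section \<open>Hoeffding bound for the empirical frequency of an event\<close>

text \<open>
  Hoeffding's inequality bounds deviations from the exact mean \<open>card I * measure P A\<close>. Replacing the
  probability of \<open>A\<close> by an upper bound \<open>q\<close> only shrinks the event.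
\<close>
lemma prob_empirical_count_ge_le:
  fixes q c :: real
  assumes "prob_space P" "finite I" "I \<noteq> {}" and [measurable]: "A \<in> sets P"
    and "measure P A \<le> q" "0 \<le> c"
  shows "\<P>(R in Pi\<^sub>M I (\<lambda>_. P). real (card I) * (q + c) \<le> (\<Sum>i\<in>I. indicator A (R i)))
    \<le> exp (- 2 * real (card I) * c\<^sup>2)"
proof -
  let ?M = "Pi\<^sub>M I (\<lambda>_. P)"
  let ?X = "\<lambda>i R. indicator A (R i) :: real"
  let ?n = "real (card I)"
  interpret M: prob_space ?M
    by (rule prob_space_PiM) (rule assms(1))
  have n: "0 < ?n" using assms(2,3) by (simp add: card_gt_0_iff)
  have component: "distr ?M P (\<lambda>R. R i) = P" if "i \<in> I" for i
    using distr_PiM_component[of I "\<lambda>_. P" i] assms(1) that by blast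
  have "M.indep_vars (\<lambda>_. P) (\<lambda>i R. R i) I"
  proof (subst M.indep_vars_iff_distr_eq_PiM')
    show "distr ?M ?M (\<lambda>R. \<lambda>i\<in>I. R i) = (\<Pi>\<^sub>M i\<in>I. distr ?M P (\<lambda>R. R i))"
    proof -
      have "distr ?M ?M (\<lambda>R. \<lambda>i\<in>I. R i) = distr ?M ?M (\<lambda>R. R)"
        by (rule distr_cong) (auto simp: space_PiM PiE_restrict)
      also have "\<dots> = (\<Pi>\<^sub>M i\<in>I. distr ?M P (\<lambda>R. R i))"
        by (auto intro!: PiM_cong simp: component)
      finally show ?thesis .
    qed
  qed (use assms(3) in auto)
  then have indep: "M.indep_vars (\<lambda>_. borel) ?X I"
    by (rule M.indep_vars_compose2) simp
  interpret H: Hoeffding_ineq ?M I ?X "\<lambda>_. 0" "\<lambda>_. 1" "\<Sum>i\<in>I. M.expectation (?X i)"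
  proof unfold_locales
    show "finite I" by (rule assms(2))
    show "M.indep_vars (\<lambda>_. borel) ?X I" by (rule indep)
    show "AE R in ?M. ?X i R \<in> {0..1}" for i by simp
  qed
  have expectation: "M.expectation (?X i) = measure P A" if "i \<in> I" for i
  proof -
    have "M.expectation (?X i) = integral\<^sup>L (distr ?M P (\<lambda>R. R i)) (indicator A)"
      using that by (subst integral_distr) auto
    also have "\<dots> = integral\<^sup>L P (indicator A)"
      using component[OF that] by simp
    also have "\<dots> = measure P A"
      using sets.sets_into_space[OF assms(4)] by (simp add: Int_absorb2)
    finally show ?thesis .
  qed
  have "M.prob {R\<in>space ?M. ?n * (q + c) \<le> (\<Sum>i\<in>I. ?X i R)}
      \<le> M.prob {R\<in>space ?M. (\<Sum>i\<in>I. M.expectation (?X i)) + ?n * c \<le> (\<Sum>i\<in>I. ?X i R)}"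
  proof (rule M.finite_measure_mono)
    have "(\<Sum>i\<in>I. M.expectation (?X i)) + ?n * c \<le> ?n * (q + c)"
      using assms(5) by (simp add: expectation distrib_left mult_left_mono)
    then show "{R\<in>space ?M. ?n * (q + c) \<le> (\<Sum>i\<in>I. ?X i R)}
        \<subseteq> {R\<in>space ?M. (\<Sum>i\<in>I. M.expectation (?X i)) + ?n * c \<le> (\<Sum>i\<in>I. ?X i R)}"
      by auto
  qed measurable
  also have "\<dots> \<le> exp (- 2 * (?n * c)\<^sup>2 / (\<Sum>i\<in>I. (1 - 0)\<^sup>2))"
    using n assms(6) by (intro H.Hoeffding_ineq_ge) auto
  also have "- 2 * (?n * c)\<^sup>2 / (\<Sum>i\<in>I. (1 - 0)\<^sup>2) = - 2 * ?n * c\<^sup>2"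
    using n by (simp add: field_simps power2_eq_square)
  finally show ?thesis .
qed

section \<open>Robust conformal coverage\<close>

theorem theorem5p6:
  fixes X :: "real set" and P P_test :: "real measure"
    and \<delta> \<beta> \<eta> \<rho> :: real and K :: nat
  assumes "0 < \<delta>" "\<delta> < 1" "0 < \<beta>" "\<beta> < 1"
    and "K \<ge> 1" and "\<eta> \<ge> 0" and "0 \<le> \<rho>" "\<rho> < \<delta>"
    and "P \<in> borel_prob_measures X"
    and "P_test \<in> borel_prob_measures X"
    and "levy_prokhorov \<eta> P P_test \<le> \<rho>"
    and "1 / (real K + 1) \<le> lp_cp_level \<delta> \<beta> K \<rho>"
    and "lp_cp_level \<delta> \<beta> K \<rho> \<le> real K / (real K + 1)"
  shows "\<P>(R in iid_law K P.
            \<P>(R0 in P_test. ereal R0 \<le> lp_cp_threshold \<delta> \<beta> K \<rho> \<eta> R) \<ge> 1 - \<delta>) \<ge> 1 - \<beta>"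
proof -
  have P: "prob_space P" "sets P = sets (restrict_space borel X)"
    and P_test: "prob_space P_test" "sets P_test = sets (restrict_space borel X)"
    using assms(9,10) by (auto simp: space_prob_algebra)
  have meas [measurable]: "(\<lambda>x. x) \<in> borel_measurable P" "(\<lambda>x. x) \<in> borel_measurable P_test"
    by (simp_all add: measurable_cong_sets[OF P(2) refl] measurable_cong_sets[OF P_test(2) refl]
        measurable_restrict_space1)
  interpret test: prob_space P_test by (rule P_test(1))
  interpret D: real_distribution "distr P_test borel (\<lambda>x. x)"
    by (rule test.real_distribution_distr) (rule meas(2))
  obtain y where y: "\<And>t. 1 - \<delta> \<le> cdf (distr P_test borel (\<lambda>x. x)) t \<longleftrightarrow> y \<le> t"
    and y_left: "measure (distr P_test borel (\<lambda>x. x)) {..<y} \<le> 1 - \<delta>"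
    using D.quantile_exists[of "1 - \<delta>"] assms(1,2) by auto
  have cdf_eq: "cdf (distr P_test borel (\<lambda>x. x)) t = test.prob {x\<in>space P_test. x \<le> t}" for t
    unfolding cdf_def
    by (subst measure_distr[OF meas(2)]) (auto intro!: arg_cong[where f = test.prob])
  have left_eq: "measure (distr P_test borel (\<lambda>x. x)) {..<y} = test.prob {x\<in>space P_test. x < y}"
    by (subst measure_distr[OF meas(2)]) (auto intro!: arg_cong[where f = test.prob])
  define A where "A = {x\<in>space P. x < y - \<eta>}"
  have A [measurable]: "A \<in> sets P"
    unfolding A_def by measurable
  have A_le: "measure P A \<le> 1 - \<delta> + \<rho>"
    using measure_lessThan_le_levy_prokhorov[OF P(1) P_test(1) meas, of y \<eta>] y_left left_eq assms(11)
    unfolding A_def by linarith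
  define p where "p = lp_cp_level \<delta> \<beta> K \<rho>"
  define c where "c = sqrt (ln (1 / \<beta>) / (2 * real K))"
  have p_eq: "p = 1 - \<delta> + \<rho> + c"
    by (simp add: p_def c_def lp_cp_level_def)
  have "real K / (real K + 1) \<le> 1" by simp
  moreover have "0 < 1 / (real K + 1)" by simp
  ultimately have p: "0 < p" "p \<le> 1"
    using assms(12,13) unfolding p_def by linarith+
  have good_iff: "1 - \<delta> \<le> test.prob {x\<in>space P_test. ereal x \<le> lp_cp_threshold \<delta> \<beta> K \<rho> \<eta> R}
      \<longleftrightarrow> (\<Sum>i\<in>{1..K}. indicator A (R i)) < real (K + 1) * p"
    if R: "R \<in> space (iid_law K P)" for R
  proof -
    let ?xs = "map (\<lambda>i. ereal (R i)) [1..<Suc K] @ [\<infinity>]"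
    have "quantile p ?xs \<in> set ?xs" by (rule quantile_in_set) (use p in auto)
    then have "quantile p ?xs \<noteq> -\<infinity>" by auto
    \<comment> \<open>If the quantile is \<open>\<infinity>\<close>, both sides hold: the test sample is covered with probability 1.\<close>
    then have "1 - \<delta> \<le> test.prob {x\<in>space P_test. ereal x \<le> quantile p ?xs + ereal \<eta>}
        \<longleftrightarrow> ereal (y - \<eta>) \<le> quantile p ?xs"
      using y cdf_eq test.prob_space assms(1)
      by (cases "quantile p ?xs") (auto simp: diff_le_eq)
    also have "\<dots> \<longleftrightarrow> (\<Sum>i\<in>{1..K}. indicator {..<y - \<eta>} (R i)) < real (K + 1) * p"
      by (rule le_quantile_iff[OF p])
    also have "(\<Sum>i\<in>{1..K}. indicator {..<y - \<eta>} (R i)) = (\<Sum>i\<in>{1..K}. indicator A (R i) :: real)"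
      using R by (intro sum.cong) (auto simp: A_def indicator_def space_PiM PiE_iff)
    finally show ?thesis
      by (simp add: lp_cp_threshold_def p_def)
  qed
  interpret M: prob_space "iid_law K P"
    by (rule prob_space_PiM) (rule P(1))
  let ?bad = "{R\<in>space (iid_law K P). real (card {1..K}) * (1 - \<delta> + \<rho> + c) \<le> (\<Sum>i\<in>{1..K}. indicator A (R i))}"
  have c: "0 \<le> c" "2 * real K * c\<^sup>2 = ln (1 / \<beta>)"
    using assms(3,4,5) by (auto simp: c_def)
  have "M.prob ?bad \<le> exp (- 2 * real (card {1..K}) * c\<^sup>2)"
    using A_le c(1) assms(5) by (intro prob_empirical_count_ge_le[OF P(1)]) auto
  also have "- 2 * real (card {1..K}) * c\<^sup>2 = ln \<beta>"
    using c(2) assms(3) by (simp add: ln_div)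
  also have "exp (ln \<beta>) = \<beta>"
    using assms(3) by simp
  finally have "1 - \<beta> \<le> 1 - M.prob ?bad"
    by simp
  also have "\<dots> = M.prob (space (iid_law K P) - ?bad)"
    by (rule M.prob_compl[symmetric]) measurable
  also have "\<dots> \<le> M.prob {R\<in>space (iid_law K P).
      (\<Sum>i\<in>{1..K}. indicator A (R i)) < real (K + 1) * p}"
  proof (rule M.finite_measure_mono)
    \<comment> \<open>The extra entry \<open>\<infinity>\<close> raises the rank from \<open>K p\<close> to \<open>(K + 1) p\<close>, which only helps coverage.\<close>
    have "real K * p \<le> real (K + 1) * p"
      using p(1) by simp
    then show "space (iid_law K P) - ?bad \<subseteq> {R\<in>space (iid_law K P).
        (\<Sum>i\<in>{1..K}. indicator A (R i)) < real (K + 1) * p}"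
      by (auto simp: p_eq)
  qed measurable
  also have "{R\<in>space (iid_law K P). (\<Sum>i\<in>{1..K}. indicator A (R i)) < real (K + 1) * p}
      = {R\<in>space (iid_law K P). 1 - \<delta> \<le>
          test.prob {x\<in>space P_test. ereal x \<le> lp_cp_threshold \<delta> \<beta> K \<rho> \<eta> R}}"
    using good_iff by blast
  finally show ?thesis .
qed

end
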